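(* For every finite set $S=S_f\cup S_C$ (with $S_C$ equations between constants of a finite set $C$ and $S_f$ equations between $f$-monomials over $C$, $f$ a cancelative AC symbol) and every total admissible ordering $\gg_f$ on $f$-monomials extending a total ordering $\gg_C$ on $C$, the algorithm CancelativeACCompletion$(S,\gg_f)$ terminates; that is, rules cannot be added to $R_f$ infinitely often.
   Context: $f$-monomials: $f(M)$ with $M$ a finite multiset over $C$, nonempty unless $f$ has an identity $e$ (then $f(\{\!\{\}\!\})$ denotes $e$); a constant $c$ is identified with $f(\{\!\{c\}\!\})$. On multisets $\cup$ is multiset sum, $\cap$ multiset intersection, $-$ truncated multiset difference, $\subseteq$ sub-multiset. A rule $f(A)\rightarrow f(B)$ rewrites $f(M)$ to $f((M-A)\cup B)$ when $A\subseteq M$. Admissible ordering: total well-founded ordering on $f$-monomials extending $\gg_C$, with $f(A)\gg_f f(B)$ when $B$ is a proper sub-multiset of $A$, and $f(A_1)\gg_f f(A_2)\Rightarrow f(A_1\cup B)\gg_f f(A_2\cup B)$. $f$ is cancelative: $f(x,y)=f(x,z)\Rightarrow y=z$. Cancelativity closed: $f(A)=f(B)$ with $A\cap B$ empty, or $f$ without identity, $A\cap B$ a singleton and exactly one of $A,B$ a singleton. $CancelClose(\{f(A)=f(B)\})$: itself if cancelativity closed; otherwise $\{f(A-B)=f(B-A)\}$ if $f$ has an identity or if neither $A-B$ nor $B-A$ is empty; and if $f$ has no identity and one of $A-B,B-A$ is empty, $\{f((A-B)\cup\{\!\{c\}\!\})=f((B-A)\cup\{\!\{c\}\!\})\mid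 c\in C\}$. Classical critical pair of distinct rules $f(A_1)\rightarrow f(A_2)$, $f(B_1)\rightarrow f(B_2)$: $(f((AB-A_1)\cup A_2),f((AB-B_1)\cup B_2))$ with $AB=(A_1\cup B_1)-(A_1\cap B_1)$. Cancelative disjoint critical pairs of distinct rules $f(A_1)\rightarrow f(B_1)$, $f(A_2)\rightarrow f(B_2)$ whose sides $A_1\cup A_2$, $B_1\cup B_2$ share an element: the equations of $CancelClose(\{f(A_1\cup A_2)=f(B_1\cup B_2)\})$. Algorithm CancelativeACCompletion$(S,\gg_f)$: (1) Let $R_C$ map each constant to the $\gg_C$-least constant of its equivalence class generated by $S_C$. (2) Replace $S_f$ by the union of $CancelClose(\{f(A)=f(B)\})$ over its equations. (3) Remove constant equalities from $S_f$ and update $R_C$ with them. (4) $R_f:=R_C$. (5) $T:=S_f$. (6) Pick and remove $l=r$ from $T$; compute normal forms $\hat l,\hat r$ w.r.t. $R_f$; if equal discard; otherwise for each $l'=r'\in CancelClose(\{\hat l=\hat r\})$: (a) orient it by $\gg_f$, say $l'\rightarrow r'$; (b) add to $T$ both the classical critical pairs and the cancelative disjoint critical pairs between $l'\rightarrow r'$ and every rule in $R_f$; (c) add $l'\rightarrow r'$ to $R_f$; (d) interreduce: each other rule of $R_f$ whose left side is reducible by $l'\rightarrow r'$ is removed and its equation put into $T$, and each rule whose only right side is reducible has its right side replaced by a normal form. (7) Repeat step (6) until both kinds of critical pairs among all pairs of rules of $R_f$ are joinable and $T$ is empty. (8) Output $R_f$. *)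

theory Defs
  imports "HOL-Library.Multiset"
begin

text \<open>
  The monomial \<open>f(M)\<close> is represented by the multiset \<open>M\<close>, and the constant \<open>c\<close> by \<open>{#c#}\<close>.
  Throughout, \<open>C\<close> is the set of constants and the Boolean \<open>e\<close> says whether \<open>f\<close> has an
  identity, in which case \<open>{#}\<close> stands for the identity. Equations and rules are pairs of
  multisets; an equation may be stored in either orientation.
\<close>

type_synonym 'c eqn = "'c multiset \<times> 'c multiset"
type_synonym 'c rule = "'c multiset \<times> 'c multiset"

definition monomials :: "'c set \<Rightarrow> bool \<Rightarrow> 'c multiset set" where
  "monomials C e = {M. set_mset M \<subseteq> C \<and> (M = {#} \<longrightarrow> e)}"

definition strict_total_order_on :: "'a set \<Rightarrow> ('a \<Rightarrow> 'a \<Rightarrow> bool) \<Rightarrow> bool" where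
  "strict_total_order_on A gt \<longleftrightarrow> irreflp_on A gt \<and> transp_on A gt \<and> totalp_on A gt"

text \<open>\<open>gt M N\<close> reads: \<open>M\<close> is greater than \<open>N\<close>; hence the flipped arguments under \<^const>\<open>wfp_on\<close>.\<close>

definition admissible ::
  "'c set \<Rightarrow> bool \<Rightarrow> ('c \<Rightarrow> 'c \<Rightarrow> bool) \<Rightarrow> ('c multiset \<Rightarrow> 'c multiset \<Rightarrow> bool) \<Rightarrow> bool" where
  "admissible C e gtC gt \<longleftrightarrow>
     strict_total_order_on (monomials C e) gt \<and>
     wfp_on (monomials C e) (\<lambda>M N. gt N M) \<and>
     (\<forall>a\<in>C. \<forall>b\<in>C. gtC a b \<longrightarrow> gt {#a#} {#b#}) \<and>
     (\<forall>A\<in>monomials C e. \<forall>B\<in>monomials C e. B \<subset># A \<longrightarrow> gt A B) \<and>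
     (\<forall>A1\<in>monomials C e. \<forall>A2\<in>monomials C e. \<forall>B\<in>monomials C e.
        gt A1 A2 \<longrightarrow> gt (A1 + B) (A2 + B))"

definition rewrite :: "'c rule set \<Rightarrow> 'c multiset \<Rightarrow> 'c multiset \<Rightarrow> bool" where
  "rewrite R M N \<longleftrightarrow> (\<exists>(A, B)\<in>R. A \<subseteq># M \<and> N = (M - A) + B)"

definition reducible :: "'c rule set \<Rightarrow> 'c multiset \<Rightarrow> bool" where
  "reducible R M \<longleftrightarrow> (\<exists>N. rewrite R M N)"

definition normal_form :: "'c rule set \<Rightarrow> 'c multiset \<Rightarrow> 'c multiset \<Rightarrow> bool" where
  "normal_form R M N \<longleftrightarrow> (rewrite R)\<^sup>*\<^sup>* M N \<and> \<not> reducible R N"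

definition joinable :: "'c rule set \<Rightarrow> 'c eqn \<Rightarrow> bool" where
  "joinable R = (\<lambda>(M, N). \<exists>K. (rewrite R)\<^sup>*\<^sup>* M K \<and> (rewrite R)\<^sup>*\<^sup>* N K)"

definition cancel_closed :: "bool \<Rightarrow> 'c eqn \<Rightarrow> bool" where
  "cancel_closed e = (\<lambda>(A, B).
     A \<inter># B = {#} \<or>
     \<not> e \<and> size (A \<inter># B) = 1 \<and> (size A = 1) \<noteq> (size B = 1))"

definition cancel_close :: "'c set \<Rightarrow> bool \<Rightarrow> 'c eqn \<Rightarrow> 'c eqn set" where
  "cancel_close C e = (\<lambda>(A, B).
     if cancel_closed e (A, B) then {(A, B)}
     else if e \<or> A - B \<noteq> {#} \<and> B - A \<noteq> {#} then {(A - B, B - A)}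
     else {((A - B) + {#c#}, (B - A) + {#c#}) | c. c \<in> C})"

definition classical_cps :: "'c rule \<Rightarrow> 'c rule \<Rightarrow> 'c eqn set" where
  "classical_cps = (\<lambda>(A1, A2) (B1, B2).
     if (A1, A2) = (B1, B2) then {}
     else let AB = (A1 + B1) - (A1 \<inter># B1) in {((AB - A1) + A2, (AB - B1) + B2)})"

definition disjoint_cps :: "'c set \<Rightarrow> bool \<Rightarrow> 'c rule \<Rightarrow> 'c rule \<Rightarrow> 'c eqn set" where
  "disjoint_cps C e = (\<lambda>(A1, B1) (A2, B2).
     if (A1, B1) \<noteq> (A2, B2) \<and> (A1 + A2) \<inter># (B1 + B2) \<noteq> {#}
     then cancel_close C e (A1 + A2, B1 + B2)
     else {})"

definition critical_pairs :: "'c set \<Rightarrow> bool \<Rightarrow> 'c rule \<Rightarrow> 'c rule \<Rightarrow> 'c eqn set" where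
  "critical_pairs C e \<rho> \<rho>' = classical_cps \<rho> \<rho>' \<union> disjoint_cps C e \<rho> \<rho>'"

definition least_in_class :: "('c \<Rightarrow> 'c \<Rightarrow> bool) \<Rightarrow> ('c \<times> 'c) set \<Rightarrow> 'c \<Rightarrow> 'c \<Rightarrow> bool" where
  "least_in_class gtC E c d \<longleftrightarrow>
     equivclp (\<lambda>a b. (a, b) \<in> E) c d \<and>
     (\<forall>d'. equivclp (\<lambda>a b. (a, b) \<in> E) c d' \<longrightarrow> d' = d \<or> gtC d' d)"

text \<open>The map \<open>R\<^sub>C\<close> as a set of rules, leaving out the constants that it maps to themselves.\<close>

definition const_rules :: "'c set \<Rightarrow> ('c \<Rightarrow> 'c \<Rightarrow> bool) \<Rightarrow> ('c \<times> 'c) set \<Rightarrow> 'c rule set" where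
  "const_rules C gtC E =
     {({#c#}, {#d#}) | c d. c \<in> C \<and> c \<noteq> d \<and> least_in_class gtC E c d}"

text \<open>
  A state consists of \<open>R\<^sub>f\<close>, of \<open>T\<close>, and of the equations that the inner loop (over the
  cancelative closure of the equation picked last) has yet to process.
\<close>

type_synonym 'c cac_state = "'c rule set \<times> 'c eqn set \<times> 'c eqn set"

definition cac_init ::
  "'c set \<Rightarrow> bool \<Rightarrow> ('c \<Rightarrow> 'c \<Rightarrow> bool) \<Rightarrow> 'c eqn set \<Rightarrow> ('c \<times> 'c) set \<Rightarrow> 'c cac_state" where
  "cac_init C e gtC S\<^sub>f S\<^sub>C =
     (let S' = (\<Union>eq\<in>S\<^sub>f. cancel_close C e eq);
          E = {(a, b). ({#a#}, {#b#}) \<in> S'}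
      in (const_rules C gtC (S\<^sub>C \<union> E), S' - {({#a#}, {#b#}) | a b. True}, {}))"

definition cac_done :: "'c set \<Rightarrow> bool \<Rightarrow> 'c rule set \<Rightarrow> 'c eqn set \<Rightarrow> bool" where
  "cac_done C e R T \<longleftrightarrow>
     (\<forall>\<rho>\<in>R. \<forall>\<rho>'\<in>R. \<forall>eq\<in>critical_pairs C e \<rho> \<rho>'. joinable R eq) \<and> T = {}"

inductive cac_pick :: "'c set \<Rightarrow> bool \<Rightarrow> 'c cac_state \<Rightarrow> 'c cac_state \<Rightarrow> bool"
  for C :: "'c set" and e :: bool where
  "cac_pick C e (R, T, {})
     (R, T - {(l, r)}, if l' = r' then {} else cancel_close C e (l', r'))"
  if "\<not> cac_done C e R T" and "(l, r) \<in> T"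
    and "normal_form R l l'" and "normal_form R r r'"

text \<open>
  In the next rule, \<open>K\<close> are the old rules kept by interreduction, and \<open>g\<close> yields the new right
  side of each of them; distinct rules may be given arbitrary normal forms.
\<close>

inductive cac_add ::
  "'c set \<Rightarrow> bool \<Rightarrow> ('c multiset \<Rightarrow> 'c multiset \<Rightarrow> bool) \<Rightarrow> 'c cac_state \<Rightarrow> 'c cac_state \<Rightarrow> bool"
  for C :: "'c set" and e :: bool and gt :: "'c multiset \<Rightarrow> 'c multiset \<Rightarrow> bool" where
  "cac_add C e gt (R, T, P)
     (insert (l, r) ((\<lambda>\<rho>. (fst \<rho>, g \<rho>)) ` K),
      T \<union> (\<Union>\<rho>\<in>R. critical_pairs C e (l, r) \<rho>) \<union> D,
      P - {eq})"
  if "eq \<in> P" and "eq = (l, r) \<or> eq = (r, l)" and "gt l r"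
    and "D = {\<rho> \<in> R - {(l, r)}. reducible {(l, r)} (fst \<rho>)}"
    and "K = R - {(l, r)} - D"
    and "\<And>\<rho>. \<rho> \<in> K \<Longrightarrow>
           if reducible {(l, r)} (snd \<rho>) then normal_form (insert (l, r) K) (snd \<rho>) (g \<rho>)
           else g \<rho> = snd \<rho>"

definition cac_step ::
  "'c set \<Rightarrow> bool \<Rightarrow> ('c multiset \<Rightarrow> 'c multiset \<Rightarrow> bool) \<Rightarrow> 'c cac_state \<Rightarrow> 'c cac_state \<Rightarrow> bool" where
  "cac_step C e gt s s' \<longleftrightarrow> cac_pick C e s s' \<or> cac_add C e gt s s'"

text \<open>Executions as infinite sequences, which stay put once no step applies.\<close>

definition cac_run ::
  "'c set \<Rightarrow> bool \<Rightarrow> ('c multiset \<Rightarrow> 'c multiset \<Rightarrow> bool) \<Rightarrow> 'c cac_state \<Rightarrow> (nat \<Rightarrow> 'c cac_state) \<Rightarrow> bool" where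
  "cac_run C e gt s \<sigma> \<longleftrightarrow>
     \<sigma> 0 = s \<and>
     (\<forall>i. cac_step C e gt (\<sigma> i) (\<sigma> (Suc i)) \<or>
          (\<nexists>s'. cac_step C e gt (\<sigma> i) s') \<and> \<sigma> (Suc i) = \<sigma> i)"

end

theory Submission
  imports Defs "HOL.Topological_Spaces"
begin

text \<open>
  The monomials reducible by the current rules form an ideal. It never shrinks, since
  interreduction only drops rules whose left side the new rule reduces. Whenever the picked
  equation has distinct normal forms, its cancelative closure contains an equation with both
  sides irreducible; however that equation is oriented, the ideal has grown properly by the time
  it is added. By Dickson's lemma the ideal therefore stabilises, and from then on only the
  finite sets of pending equations get consumed.
\<close>

section \<open>Dickson's lemma for multisets over a finite set\<close>

text \<open>Every sequence has a monotone subsequence; if that one decreases, it is constant from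
  its minimum on, and this tail is also increasing.\<close>

lemma nat_seq_mono_subseq:
  fixes s :: "nat \<Rightarrow> nat"
  obtains \<phi> :: "nat \<Rightarrow> nat" where "strict_mono \<phi>" and "mono (\<lambda>n. s (\<phi> n))"
proof -
  obtain \<phi> :: "nat \<Rightarrow> nat" where \<phi>: "strict_mono \<phi>" "monoseq (\<lambda>n. s (\<phi> n))"
    using seq_monosub[of s] by blast
  show ?thesis
  proof (cases "mono (\<lambda>n. s (\<phi> n))")
    case True
    then show ?thesis using \<phi> that by blast
  next
    case False
    then have dec: "decseq (\<lambda>n. s (\<phi> n))"
      using \<phi> by (auto simp: monoseq_iff)
    \<comment> \<open>\<open>n\<close> is an index at which the decreasing subsequence attains its
      minimum.\<close>
    obtain n where n: "\<And>m. s (\<phi> n) \<le> s (\<phi> m)"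
      using ex_has_least_nat[of "\<lambda>_. True" 0 "\<lambda>n. s (\<phi> n)"] by auto
    have const: "s (\<phi> (k + n)) = s (\<phi> n)" for k
      using n dec by (simp add: decseq_def le_antisym)
    have "strict_mono (\<lambda>k. \<phi> (k + n))"
      using \<phi>(1) by (simp add: strict_mono_def)
    moreover have "mono (\<lambda>k. s (\<phi> (k + n)))"
      by (simp add: const mono_def)
    ultimately show ?thesis using that by blast
  qed
qed

text \<open>The sequence is thinned out once per element of \<open>C\<close>; passing to a further
  subsequence keeps the monotonicity already achieved.\<close>

lemma mset_seq_mono_counts_subseq:
  fixes f :: "nat \<Rightarrow> 'a multiset"
  assumes "finite C"
  shows "\<exists>\<phi> :: nat \<Rightarrow> nat. strict_mono \<phi> \<and> (\<forall>c\<in>C. mono (\<lambda>n. count (f (\<phi> n)) c))"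
  using assms
proof induction
  case empty
  show ?case by (auto intro: exI[of _ id] simp: strict_mono_def)
next
  case (insert c C)
  then obtain \<phi> :: "nat \<Rightarrow> nat" where \<phi>: "strict_mono \<phi>"
    "\<And>c. c \<in> C \<Longrightarrow> mono (\<lambda>n. count (f (\<phi> n)) c)"
    by blast
  obtain \<psi> :: "nat \<Rightarrow> nat" where \<psi>: "strict_mono \<psi>" "mono (\<lambda>n. count (f (\<phi> (\<psi> n))) c)"
    using nat_seq_mono_subseq[of "\<lambda>n. count (f (\<phi> n)) c"] by blast
  have "strict_mono (\<lambda>n. \<phi> (\<psi> n))"
    using \<phi>(1) \<psi>(1) by (simp add: strict_mono_def)
  moreover have "mono (\<lambda>n. count (f (\<phi> (\<psi> n))) d)" if "d \<in> C" for d
    using \<phi>(2)[OF that] strict_mono_mono[OF \<psi>(1)] by (simp add: mono_def)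
  ultimately show ?case using \<psi>(2) by (intro exI[of _ "\<lambda>n. \<phi> (\<psi> n)"]) auto
qed

text \<open>The first two terms of a subsequence with all counts over \<open>C\<close> increasing
  are comparable, since counts outside \<open>C\<close> vanish.\<close>

lemma dickson_mset:
  fixes f :: "nat \<Rightarrow> 'a multiset"
  assumes "finite C" and "\<And>n. set_mset (f n) \<subseteq> C"
  obtains i j where "i < j" and "f i \<subseteq># f j"
proof -
  obtain \<phi> :: "nat \<Rightarrow> nat" where \<phi>: "strict_mono \<phi>"
    "\<And>c. c \<in> C \<Longrightarrow> mono (\<lambda>n. count (f (\<phi> n)) c)"
    using mset_seq_mono_counts_subseq[OF assms(1)] by blast
  have "count (f (\<phi> 0)) c \<le> count (f (\<phi> 1)) c" for c
  proof (cases "c \<in> C")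
    case True
    then show ?thesis using \<phi>(2) by (simp add: mono_def)
  next
    case False
    then have "c \<notin># f (\<phi> 0)" using assms(2) by blast
    then show ?thesis by (simp add: not_in_iff)
  qed
  then have "f (\<phi> 0) \<subseteq># f (\<phi> 1)" by (simp add: mset_subset_eqI)
  moreover have "\<phi> 0 < \<phi> 1" using \<phi>(1) by (simp add: strict_mono_def)
  ultimately show ?thesis using that by blast
qed

section \<open>Monomial ideals and the ascending chain condition\<close>

definition mset_ideal :: "'a set \<Rightarrow> 'a multiset set \<Rightarrow> bool" where
  "mset_ideal C I \<longleftrightarrow> (\<forall>M\<in>I. set_mset M \<subseteq> C) \<and>
     (\<forall>M\<in>I. \<forall>N. M \<subseteq># N \<longrightarrow> set_mset N \<subseteq> C \<longrightarrow> N \<in> I)"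

text \<open>The larger ideal counts as the smaller element, so that well-foundedness is the
  ascending chain condition.\<close>

definition ideal_less :: "'a set \<Rightarrow> ('a multiset set \<times> 'a multiset set) set" where
  "ideal_less C = {(J, I). mset_ideal C I \<and> mset_ideal C J \<and> I \<subset> J}"

text \<open>Choose \<open>M i\<close> new in \<open>I (Suc i)\<close>. Dickson's lemma makes some
  \<open>M j\<close> with \<open>i < j\<close> a multiple of \<open>M i\<close>, hence an element of
  \<open>I (Suc i) \<subseteq> I j\<close>, although it was chosen outside
  \<open>I j\<close>.\<close>

lemma wf_ideal_less:
  assumes "finite C"
  shows "wf (ideal_less C)"
  unfolding wf_iff_no_infinite_down_chain
proof
  assume "\<exists>I. \<forall>i. (I (Suc i), I i) \<in> ideal_less C"
  then obtain I where I: "\<And>i. mset_ideal C (I i)" "\<And>i. I i \<subset> I (Suc i)"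
    unfolding ideal_less_def by blast
  have mono: "I i \<subseteq> I j" if "i \<le> j" for i j
    using lift_Suc_mono_le[of I i j] I(2) that by blast
  have "\<exists>M. M \<in> I (Suc i) \<and> M \<notin> I i" for i
    using I(2)[of i] by blast
  then obtain M where M: "\<And>i. M i \<in> I (Suc i)" "\<And>i. M i \<notin> I i"
    by metis
  have sub: "set_mset (M i) \<subseteq> C" for i
    using I(1)[of "Suc i"] M(1)[of i] by (simp add: mset_ideal_def)
  obtain i j where ij: "i < j" "M i \<subseteq># M j"
    by (rule dickson_mset[OF assms sub])
  have "M j \<in> I (Suc i)"
    using I(1)[of "Suc i"] M(1)[of i] ij(2) sub[of j] unfolding mset_ideal_def by blast
  then have "M j \<in> I j" using mono[of "Suc i" j] ij(1) by auto
  then show False using M(2) by blast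
qed

section \<open>Reducibility and cancelative closure\<close>

lemma reducible_iff: "reducible R M \<longleftrightarrow> (\<exists>\<rho>\<in>R. fst \<rho> \<subseteq># M)"
  by (force simp: reducible_def rewrite_def)

lemma not_reducible_subset:
  assumes "\<not> reducible R N" and "M \<subseteq># N"
  shows "\<not> reducible R M"
  using assms by (auto simp: reducible_iff intro: subset_mset.order_trans)

definition eqns_over :: "'c set \<Rightarrow> 'c eqn set" where
  "eqns_over C = {(A, B). set_mset A \<subseteq> C \<and> set_mset B \<subseteq> C}"

lemma rewrites_over:
  assumes "(rewrite R)\<^sup>*\<^sup>* M N" and "R \<subseteq> eqns_over C" and "set_mset M \<subseteq> C"
  shows "set_mset N \<subseteq> C"
  using assms(1,3)
proof induction
  case (step N K)
  then show ?case
    using assms(2) by (fastforce simp: rewrite_def eqns_over_def dest: in_diffD)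
qed

text \<open>Only the last branch yields several equations, at most one per constant.\<close>

lemma finite_cancel_close: "finite C \<Longrightarrow> finite (cancel_close C e eq)"
  by (cases eq) (auto simp: cancel_close_def)

lemma cancel_close_over: "eq \<in> eqns_over C \<Longrightarrow> cancel_close C e eq \<subseteq> eqns_over C"
  by (cases eq) (auto simp: cancel_close_def eqns_over_def split: if_splits dest!: in_diffD)

lemma finite_critical_pairs: "finite C \<Longrightarrow> finite (critical_pairs C e \<rho> \<rho>')"
  by (cases \<rho>; cases \<rho>')
    (simp add: critical_pairs_def classical_cps_def disjoint_cps_def finite_cancel_close Let_def)

lemma critical_pairs_over:
  assumes "\<rho> \<in> eqns_over C" and "\<rho>' \<in> eqns_over C"
  shows "critical_pairs C e \<rho> \<rho>' \<subseteq> eqns_over C"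
proof -
  obtain A1 A2 B1 B2 where [simp]: "\<rho> = (A1, A2)" "\<rho>' = (B1, B2)"
    by (cases \<rho>; cases \<rho>') blast
  have "cancel_close C e (A1 + B1, A2 + B2) \<subseteq> eqns_over C"
    using assms by (intro cancel_close_over) (auto simp: eqns_over_def)
  moreover have "classical_cps \<rho> \<rho>' \<subseteq> eqns_over C"
    using assms by (auto simp: classical_cps_def eqns_over_def Let_def dest!: in_diffD)
  ultimately show ?thesis
    by (auto simp: critical_pairs_def disjoint_cps_def)
qed

text \<open>Such an equation enlarges the ideal whichever of its sides becomes the left side of the
  rule.\<close>

definition both_irreducible :: "'c rule set \<Rightarrow> 'c eqn \<Rightarrow> bool" where
  "both_irreducible R eq \<longleftrightarrow> \<not> reducible R (fst eq) \<and> \<not> reducible R (snd eq)"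

text \<open>
  In the last case of the closure, where \<open>A \<subset># B\<close> and \<open>f\<close> has no identity, some of the sides
  \<open>(B - A) + {#c#}\<close> may be reducible; those with \<open>c \<in># A\<close> are not, being contained in \<open>B\<close>.
\<close>

lemma cancel_close_both_irreducible:
  assumes "\<not> reducible R A" and "\<not> reducible R B" and "set_mset A \<subseteq> C" and "set_mset B \<subseteq> C"
  shows "\<exists>eq\<in>cancel_close C e (A, B). both_irreducible R eq"
proof (cases "cancel_closed e (A, B)")
  case True
  then show ?thesis using assms by (simp add: cancel_close_def both_irreducible_def)
next
  case not_closed: False
  then have "A \<inter># B \<noteq> {#}"
    by (simp add: cancel_closed_def)
  then obtain c where "c \<in># A \<inter># B"
    by blast
  then have c: "c \<in># A" "c \<in># B"
    by auto
  show ?thesis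
  proof (cases "e \<or> A - B \<noteq> {#} \<and> B - A \<noteq> {#}")
    case True
    moreover have "\<not> reducible R (A - B)" "\<not> reducible R (B - A)"
      using assms not_reducible_subset[OF _ diff_subset_eq_self] by blast+
    ultimately show ?thesis
      using not_closed by (simp add: cancel_close_def both_irreducible_def)
  next
    case False
    then have close: "(A - B + {#c#}, B - A + {#c#}) \<in> cancel_close C e (A, B)"
      using not_closed c assms(3) by (auto simp: cancel_close_def)
    \<comment> \<open>Subtracting the other side removes at least one copy of \<open>c\<close>, so
      putting one back stays inside the original side.\<close>
    have "A - B + {#c#} \<subseteq># A" "B - A + {#c#} \<subseteq># B"
      using c by (auto simp: subseteq_mset_def Suc_le_eq simp flip: count_greater_zero_iff)
    then show ?thesis
      using close assms(1,2) unfolding both_irreducible_def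
      by (metis fst_conv snd_conv not_reducible_subset)
  qed
qed

section \<open>The termination measure\<close>

text \<open>Finiteness lets \<open>card\<close> drop when an element is removed; the inclusions
  confine all left sides to \<open>C\<close>, as Dickson's lemma requires.\<close>

definition cac_inv :: "'c set \<Rightarrow> 'c cac_state \<Rightarrow> bool" where
  "cac_inv C = (\<lambda>(R, T, P). finite R \<and> finite T \<and> finite P \<and>
     R \<subseteq> eqns_over C \<and> T \<subseteq> eqns_over C \<and> P \<subseteq> eqns_over C)"

text \<open>The monomial ideal generated by the left sides of \<open>R\<close>.\<close>

definition red_ideal :: "'c set \<Rightarrow> 'c rule set \<Rightarrow> 'c multiset set" where
  "red_ideal C R = {M. set_mset M \<subseteq> C \<and> reducible R M}"

lemma mset_ideal_red_ideal: "mset_ideal C (red_ideal C R)"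
  by (auto simp: mset_ideal_def red_ideal_def reducible_iff intro: subset_mset.order_trans)

text \<open>
  The second component drops when an equation with irreducible sides becomes pending; it cannot
  rise again while the ideal stays the same, because adding that equation enlarges the ideal.
\<close>

definition cac_measure :: "'c set \<Rightarrow> 'c cac_state \<Rightarrow> 'c multiset set \<times> nat \<times> nat \<times> nat" where
  "cac_measure C = (\<lambda>(R, T, P).
     (red_ideal C R, if \<exists>eq\<in>P. both_irreducible R eq then 0 else 1, card P, card T))"

definition cac_less :: "'c set \<Rightarrow> ('c cac_state \<times> 'c cac_state) set" where
  "cac_less C = inv_image (ideal_less C <*lex*> less_than <*lex*> less_than <*lex*> less_than)
     (cac_measure C)"

lemma wf_cac_less: "finite C \<Longrightarrow> wf (cac_less C)"
  by (simp add: cac_less_def wf_ideal_less wf_lex_prod)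

text \<open>The rules, hence the ideal, do not change, and \<open>P\<close> is empty beforehand.
  With equal normal forms only \<open>T\<close> shrinks; otherwise the flag drops from 1 to 0, which
  outweighs the growth of \<open>P\<close>.\<close>

lemma cac_pick_decreases:
  assumes "finite C" and "cac_inv C s" and "cac_pick C e s s'"
  shows "cac_inv C s' \<and> (s', s) \<in> cac_less C"
  using assms(3)
proof cases
  case (1 R T l r l' r')
  have inv: "finite R" "finite T" "R \<subseteq> eqns_over C" "T \<subseteq> eqns_over C"
    using assms(2) 1(1) by (auto simp: cac_inv_def)
  have lr: "set_mset l \<subseteq> C" "set_mset r \<subseteq> C"
    using inv(4) 1(4) by (auto simp: eqns_over_def)
  have l': "set_mset l' \<subseteq> C" "\<not> reducible R l'" and r': "set_mset r' \<subseteq> C" "\<not> reducible R r'"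
    using 1(5,6) lr rewrites_over[OF _ inv(3)] unfolding normal_form_def by blast+
  have "cancel_close C e (l', r') \<subseteq> eqns_over C"
    using l' r' by (intro cancel_close_over) (simp add: eqns_over_def)
  then have "cac_inv C s'"
    using inv 1(2) finite_cancel_close[OF assms(1)] by (auto simp: cac_inv_def)
  moreover have "(s', s) \<in> cac_less C"
  proof (cases "l' = r'")
    case True
    have "card (T - {(l, r)}) < card T"
      using inv(2) 1(4) by (rule card_Diff1_less)
    then show ?thesis
      using True 1(1,2) by (simp add: cac_less_def cac_measure_def)
  next
    case False
    then show ?thesis
      using 1(1,2) cancel_close_both_irreducible[OF l'(2) r'(2) l'(1) r'(1)]
      by (simp add: cac_less_def cac_measure_def)
  qed
  ultimately show ?thesis ..
qed

text \<open>Either the ideal grows, or the processed equation had a reducible side; then its removal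
  leaves the flag unchanged and \<open>card P\<close> drops, which outweighs the growth of
  \<open>T\<close>.\<close>

lemma cac_add_decreases:
  assumes "finite C" and "cac_inv C s" and "cac_add C e gt s s'"
  shows "cac_inv C s' \<and> (s', s) \<in> cac_less C"
  using assms(3)
proof cases
  case (1 eq P l r D R K g T)
  let ?R = "insert (l, r) ((\<lambda>\<rho>. (fst \<rho>, g \<rho>)) ` K)"
  have inv: "finite R" "finite T" "finite P"
    "R \<subseteq> eqns_over C" "T \<subseteq> eqns_over C" "P \<subseteq> eqns_over C"
    using assms(2) 1(1) by (auto simp: cac_inv_def)
  have lr: "(l, r) \<in> eqns_over C"
    using inv(6) 1(3,4) by (auto simp: eqns_over_def)
  have K: "K \<subseteq> R" and D: "D \<subseteq> R" using 1(6,7) by auto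
  have over: "insert (l, r) K \<subseteq> eqns_over C" using K inv(4) lr by blast
  have g: "(fst \<rho>, g \<rho>) \<in> eqns_over C" if "\<rho> \<in> K" for \<rho>
  proof -
    have \<rho>: "set_mset (fst \<rho>) \<subseteq> C" "set_mset (snd \<rho>) \<subseteq> C"
      using over that by (force simp: eqns_over_def)+
    \<comment> \<open>An unchanged right side is covered as zero rewrite steps.\<close>
    have "(rewrite (insert (l, r) K))\<^sup>*\<^sup>* (snd \<rho>) (g \<rho>)"
      using 1(8)[OF that] by (auto simp: normal_form_def split: if_splits)
    then show ?thesis
      using rewrites_over[OF _ over] \<rho> by (simp add: eqns_over_def)
  qed
  have "(\<Union>\<rho>\<in>R. critical_pairs C e (l, r) \<rho>) \<subseteq> eqns_over C"
    using critical_pairs_over[OF lr] inv(4) by blast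
  moreover have "finite (\<Union>\<rho>\<in>R. critical_pairs C e (l, r) \<rho>)"
    using inv(1) finite_critical_pairs[OF assms(1)] by blast
  ultimately have inv': "cac_inv C s'"
    using inv lr g K D finite_subset[OF K] finite_subset[OF D] 1(2)
    by (auto simp: cac_inv_def)
  have red_mono: "reducible ?R M" if red: "reducible R M" for M
  proof -
    obtain \<rho> where \<rho>: "\<rho> \<in> R" "fst \<rho> \<subseteq># M"
      using red by (auto simp: reducible_iff)
    show ?thesis
    proof (cases "\<rho> \<in> K")
      case True
      then show ?thesis using \<rho> by (auto simp: reducible_iff)
    next
      case False
      \<comment> \<open>A rule of \<open>R\<close> outside \<open>K\<close> is \<open>(l, r)\<close>
        itself or was dropped because \<open>l\<close> divides its left side.\<close>
      then have "l \<subseteq># fst \<rho>" using \<rho>(1) 1(6,7) by (auto simp: reducible_iff)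
      then show ?thesis using \<rho>(2) by (auto simp: reducible_iff intro: subset_mset.order_trans)
    qed
  qed
  have "(s', s) \<in> cac_less C"
  proof (cases "red_ideal C ?R = red_ideal C R")
    case same: True
    \<comment> \<open>The new rule reduces its own left side, so if the ideal is unchanged,
      \<open>l\<close> was already reducible by \<open>R\<close>.\<close>
    have "l \<in> red_ideal C ?R"
      using lr by (auto simp: red_ideal_def reducible_iff eqns_over_def)
    then have "l \<in> red_ideal C R" using same by simp
    then have "reducible R l" by (simp add: red_ideal_def)
    then have not_eq: "\<not> both_irreducible R eq"
      using 1(4) by (auto simp: both_irreducible_def)
    have red_same: "reducible ?R M \<longleftrightarrow> reducible R M" if "set_mset M \<subseteq> C" for M
      using same that by (auto simp: red_ideal_def set_eq_iff)
    have "both_irreducible ?R eq' \<longleftrightarrow> both_irreducible R eq'" if "eq' \<in> P" for eq'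
      using that inv(6) red_same by (auto simp: both_irreducible_def eqns_over_def)
    then have "(\<exists>eq'\<in>P - {eq}. both_irreducible ?R eq') \<longleftrightarrow> (\<exists>eq'\<in>P. both_irreducible R eq')"
      using not_eq by blast
    moreover have "card (P - {eq}) < card P"
      using inv(3) 1(3) by (rule card_Diff1_less)
    ultimately show ?thesis
      using same 1(1,2) by (simp add: cac_less_def cac_measure_def)
  next
    case False
    then have "red_ideal C R \<subset> red_ideal C ?R"
      using red_mono by (auto simp: red_ideal_def)
    then show ?thesis
      using 1(1,2) by (simp add: cac_less_def cac_measure_def ideal_less_def mset_ideal_red_ideal)
  qed
  then show ?thesis using inv' by blast
qed

section \<open>The initial state and termination of runs\<close>

lemma cac_init_inv:
  assumes "finite C" and "finite S\<^sub>f" and "S\<^sub>f \<subseteq> eqns_over C" and "S\<^sub>C \<subseteq> C \<times> C"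
  shows "cac_inv C (cac_init C e gtC S\<^sub>f S\<^sub>C)"
proof -
  define S' where "S' = (\<Union>eq\<in>S\<^sub>f. cancel_close C e eq)"
  define E where "E = S\<^sub>C \<union> {(a, b). ({#a#}, {#b#}) \<in> S'}"
  have S': "finite S'" "S' \<subseteq> eqns_over C"
    using assms(2,3) finite_cancel_close[OF assms(1)] cancel_close_over
    unfolding S'_def by blast+
  have E: "E \<subseteq> C \<times> C"
    using assms(4) S'(2) by (auto simp: E_def eqns_over_def)
  \<comment> \<open>The equivalence also relates constants outside \<open>C\<close> to themselves,
    so \<open>c \<in> C\<close> is needed to start the induction.\<close>
  have "d \<in> C" if "equivclp (\<lambda>a b. (a, b) \<in> E) c d" and "c \<in> C" for c d
    using that by (induction rule: equivclp_induct) (use E in auto)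
  then have rules: "const_rules C gtC E \<subseteq> (\<lambda>(c, d). ({#c#}, {#d#})) ` (C \<times> C)"
    by (force simp: const_rules_def least_in_class_def)
  then have "finite (const_rules C gtC E)"
    using assms(1) by (meson finite_SigmaI finite_imageI finite_subset)
  moreover have "const_rules C gtC E \<subseteq> eqns_over C"
    using rules by (fastforce simp: eqns_over_def)
  moreover have "cac_init C e gtC S\<^sub>f S\<^sub>C =
      (const_rules C gtC E, S' - {({#a#}, {#b#}) | a b. True}, {})"
    unfolding cac_init_def S'_def E_def Let_def by simp
  ultimately show ?thesis
    using S' by (auto simp: cac_inv_def)
qed

lemma cac_no_infinite_run:
  assumes "finite C" and "cac_inv C (\<sigma> 0)" and steps: "\<And>i. cac_step C e gt (\<sigma> i) (\<sigma> (Suc i))"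
  shows False
proof -
  have dec: "cac_inv C (\<sigma> (Suc i)) \<and> (\<sigma> (Suc i), \<sigma> i) \<in> cac_less C" if "cac_inv C (\<sigma> i)" for i
    using steps[of i] that cac_pick_decreases[OF assms(1)] cac_add_decreases[OF assms(1)]
    unfolding cac_step_def by blast
  have "cac_inv C (\<sigma> i)" for i
    by (induction i) (use assms(2) dec in auto)
  then have "(\<sigma> (Suc i), \<sigma> i) \<in> cac_less C" for i
    using dec by blast
  then show False
    using wf_cac_less[OF assms(1)] unfolding wf_iff_no_infinite_down_chain by blast
qed

theorem theorem5p3:
  fixes C :: "'c set" and e :: bool
    and gtC :: "'c \<Rightarrow> 'c \<Rightarrow> bool"
    and gt :: "'c multiset \<Rightarrow> 'c multiset \<Rightarrow> bool"
    and S\<^sub>f :: "'c eqn set" and S\<^sub>C :: "('c \<times> 'c) set"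
  assumes "finite C"
    and "finite S\<^sub>f" and "S\<^sub>f \<subseteq> monomials C e \<times> monomials C e"
    and "finite S\<^sub>C" and "S\<^sub>C \<subseteq> C \<times> C"
    and "strict_total_order_on C gtC"
    and "admissible C e gtC gt"
  shows "(\<nexists>\<sigma>. \<sigma> 0 = cac_init C e gtC S\<^sub>f S\<^sub>C \<and> (\<forall>i. cac_step C e gt (\<sigma> i) (\<sigma> (Suc i)))) \<and>
         (\<forall>\<sigma>. cac_run C e gt (cac_init C e gtC S\<^sub>f S\<^sub>C) \<sigma> \<longrightarrow>
            finite {i. cac_add C e gt (\<sigma> i) (\<sigma> (Suc i))})"
proof -
  have "S\<^sub>f \<subseteq> eqns_over C"
    using assms(3) by (auto simp: monomials_def eqns_over_def)
  then have init: "cac_inv C (cac_init C e gtC S\<^sub>f S\<^sub>C)"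
    using assms(1,2,5) by (intro cac_init_inv)
  have no_inf: False
    if "\<sigma> 0 = cac_init C e gtC S\<^sub>f S\<^sub>C" and "\<forall>i. cac_step C e gt (\<sigma> i) (\<sigma> (Suc i))" for \<sigma>
    using cac_no_infinite_run[OF assms(1), of \<sigma> e gt] init that by simp
  have "finite {i. cac_add C e gt (\<sigma> i) (\<sigma> (Suc i))}"
    if run: "cac_run C e gt (cac_init C e gtC S\<^sub>f S\<^sub>C) \<sigma>" for \<sigma>
  proof -
    \<comment> \<open>If no state of the run were stuck, all its moves would be genuine steps,
      contrary to \<open>no_inf\<close>.\<close>
    obtain n where n: "\<nexists>s'. cac_step C e gt (\<sigma> n) s'"
      using no_inf[of \<sigma>] run unfolding cac_run_def by blast
    have stay: "\<sigma> (n + k) = \<sigma> n" for k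
    proof (induction k)
      case (Suc k)
      then show ?case using run n unfolding cac_run_def by (metis add_Suc_right)
    qed simp
    have "i < n" if "cac_add C e gt (\<sigma> i) (\<sigma> (Suc i))" for i
    proof (rule ccontr)
      assume "\<not> i < n"
      then have "\<sigma> i = \<sigma> n" using stay[of "i - n"] by simp
      then show False using that n unfolding cac_step_def by metis
    qed
    then show ?thesis by (auto intro: finite_subset[of _ "{..<n}"])
  qed
  then show ?thesis using no_inf by blast
qed

end
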